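(* Let $X$ be a compact metric space, $G_1=\{\mathrm{id}_X,f_1,\dots,f_m\}$ a finite set of continuous self-maps of $X$, $\Phi\in\mathcal C(X,\mathbb R^m)$ a continuous multi-potential, and $Y\subset X$. Then $$P^A(\Phi,Y,G_1)\le P_l(\Phi,Y,G_1)\le P_u(\Phi,Y,G_1).$$
   Context: Let $(X,d)$ be a compact metric space, $f_1,\dots,f_m:X\to X$ continuous, $f_{j_1\dots j_n}:=f_{j_1}\circ\dots\circ f_{j_n}$. Let $\Sigma_m^*$ be the set of finite words $C=(i_1,\dots,i_n)$, $n\ge1$, over $\{1,\dots,m\}$, $n(C)=n$ the length, and $\Sigma_m^+$ the space of sequences $\omega=(\omega_0,\omega_1,\dots)$ over $\{1,\dots,m\}$. For $C=(i_1,\dots,i_n)$, $$B_n(y,C,\varepsilon)=\{z\in X: d(y,z)<\varepsilon,\ d(f_{i_k\dots i_1}(y),f_{i_k\dots i_1}(z))<\varepsilon,\ 1\le k\le n\},$$ $S_n\Phi(y,C)=\phi_{i_1}(y)+\phi_{i_2}(f_{i_1}(y))+\dots+\phi_{i_n}(f_{i_{n-1}\dots i_1}(y))$ for $\Phi=(\phi_1,\dots,\phi_m)$; for $\omega\in\Sigma_m^+$ set $B_n(y,\omega,\varepsilon)=B_n(y,(\omega_0,\dots,\omega_{n-1}),\varepsilon)$ and $S_n\Phi(y,\omega)=S_n\Phi(y,(\omega_0,\dots,\omega_{n-1}))$. Amalgamated pressure $P^A(\Phi,Y,G_1)$: $$M(\lambda,\Phi,Y,N,\varepsilon)=\inf_\Gamma\sum_{(C,y)\in\Gamma}\exp(-\lambda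 n(C)+S_{n(C)}\Phi(y,C)),$$ the infimum over at most countable $\Gamma\subset\Sigma_m^*\times X$ with $Y\subset\bigcup_{(C,y)\in\Gamma}B_{n(C)}(y,C,\varepsilon)$ and $n(C)\ge N$ for all $(C,y)\in\Gamma$; $m(\lambda,\Phi,Y,\varepsilon)=\lim_{N\to\infty}M(\lambda,\Phi,Y,N,\varepsilon)$; $P^A(\Phi,Y,G_1,\varepsilon)=\inf\{\lambda:m(\lambda,\Phi,Y,\varepsilon)=0\}$; $P^A(\Phi,Y,G_1)=\lim_{\varepsilon\to0}P^A(\Phi,Y,G_1,\varepsilon)$. Condensed pressures: the condensed ball is $B_n(x,G_1,\varepsilon)=\bigcap_{\omega\in\Sigma_m^+}B_n(x,\omega,\varepsilon)$; let $s_n\Phi(x)=\inf_{\omega\in\Sigma_m^+}S_n\Phi(x,\omega)$ and $S_n\Phi(x)=\sup_{\omega\in\Sigma_m^+}S_n\Phi(x,\omega)$. Define $$M_{l,N}(\Phi,Y,\lambda,\varepsilon)=\inf\sum_{x\in\mathcal F}\exp(s_n\Phi(x)-\lambda n),\qquad M_{u,N}(\Phi,Y,\lambda,\varepsilon)=\inf\sum_{x\in\mathcal F}\exp(S_n\Phi(x)-\lambda n),$$ the infima over at most countable families of centers $x\in\mathcal F\subset X$ with integers $n=n(x)\ge N$ (allowed to vary with $x$) such that $Y\subset\bigcup_{x\in\mathcal F}B_n(x,G_1,\varepsilon)$. Let $m_l,m_u$ be the limits of $M_{l,N},M_{u,N}$ as $N\to\infty$, $P_l(\Phi,Y,G_1,\varepsilon)=\inf\{\lambda:m_l=0\}$,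 $P_u(\Phi,Y,G_1,\varepsilon)=\inf\{\lambda:m_u=0\}$, and let $P_l(\Phi,Y,G_1)$ (lower condensed pressure) and $P_u(\Phi,Y,G_1)$ (upper condensed pressure) be the limits of these as $\varepsilon\to0$. All pressures take values in the extended reals. *)

theory Defs
  imports "HOL-Analysis.Analysis"
begin

definition words :: "nat \<Rightarrow> nat list set" where
  "words m = {C. C \<noteq> [] \<and> set C \<subseteq> {1..m}}"

definition seqs :: "nat \<Rightarrow> (nat \<Rightarrow> nat) set" where
  "seqs m = {\<omega>. range \<omega> \<subseteq> {1..m}}"

(* comp_word f [j1, ..., jn] is f j1 o ... o f jn, the last letter acting first; the orbit of y
   along C = (i1, ..., in) therefore uses the reversed prefixes comp_word f [ik, ..., i1]. *)
definition comp_word :: "(nat \<Rightarrow> 'a \<Rightarrow> 'a) \<Rightarrow> nat list \<Rightarrow> 'a \<Rightarrow> 'a" where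
  "comp_word f js = foldr (\<lambda>j g. f j \<circ> g) js id"

definition bowen_ball ::
  "'a::metric_space set \<Rightarrow> (nat \<Rightarrow> 'a \<Rightarrow> 'a) \<Rightarrow> 'a \<Rightarrow> nat list \<Rightarrow> real \<Rightarrow> 'a set" where
  "bowen_ball X f y C \<epsilon> = {z \<in> X. dist y z < \<epsilon> \<and>
     (\<forall>k\<in>{1..length C}.
        dist (comp_word f (rev (take k C)) y) (comp_word f (rev (take k C)) z) < \<epsilon>)}"

definition birkhoff_sum ::
  "(nat \<Rightarrow> 'a \<Rightarrow> 'a) \<Rightarrow> (nat \<Rightarrow> 'a \<Rightarrow> real) \<Rightarrow> 'a \<Rightarrow> nat list \<Rightarrow> real" where
  "birkhoff_sum f \<Phi> y C = (\<Sum>k<length C. \<Phi> (C ! k) (comp_word f (rev (take k C)) y))"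

definition seq_prefix :: "nat \<Rightarrow> (nat \<Rightarrow> nat) \<Rightarrow> nat list" where
  "seq_prefix n \<omega> = map \<omega> [0..<n]"

definition amalg_covers ::
  "'a::metric_space set \<Rightarrow> nat \<Rightarrow> (nat \<Rightarrow> 'a \<Rightarrow> 'a) \<Rightarrow> 'a set \<Rightarrow> nat \<Rightarrow> real
    \<Rightarrow> (nat list \<times> 'a) set set" where
  "amalg_covers X m f Y N \<epsilon> = {\<Gamma>. countable \<Gamma> \<and> \<Gamma> \<subseteq> words m \<times> X \<and>
     Y \<subseteq> (\<Union>(C, y)\<in>\<Gamma>. bowen_ball X f y C \<epsilon>) \<and> (\<forall>(C, y)\<in>\<Gamma>. N \<le> length C)}"

definition amalg_M ::
  "'a::metric_space set \<Rightarrow> nat \<Rightarrow> (nat \<Rightarrow> 'a \<Rightarrow> 'a) \<Rightarrow> (nat \<Rightarrow> 'a \<Rightarrow> real) \<Rightarrow> 'a set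
    \<Rightarrow> real \<Rightarrow> nat \<Rightarrow> real \<Rightarrow> ennreal" where
  "amalg_M X m f \<Phi> Y lam N \<epsilon> = (INF \<Gamma>\<in>amalg_covers X m f Y N \<epsilon>.
     \<Sum>\<^sub>\<infinity>(C, y)\<in>\<Gamma>. ennreal (exp (- lam * real (length C) + birkhoff_sum f \<Phi> y C)))"

definition amalg_m ::
  "'a::metric_space set \<Rightarrow> nat \<Rightarrow> (nat \<Rightarrow> 'a \<Rightarrow> 'a) \<Rightarrow> (nat \<Rightarrow> 'a \<Rightarrow> real) \<Rightarrow> 'a set
    \<Rightarrow> real \<Rightarrow> real \<Rightarrow> ennreal" where
  "amalg_m X m f \<Phi> Y lam \<epsilon> = lim (\<lambda>N. amalg_M X m f \<Phi> Y lam N \<epsilon>)"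

definition amalg_pressure_at ::
  "'a::metric_space set \<Rightarrow> nat \<Rightarrow> (nat \<Rightarrow> 'a \<Rightarrow> 'a) \<Rightarrow> (nat \<Rightarrow> 'a \<Rightarrow> real) \<Rightarrow> 'a set
    \<Rightarrow> real \<Rightarrow> ereal" where
  "amalg_pressure_at X m f \<Phi> Y \<epsilon> = Inf (ereal ` {lam. amalg_m X m f \<Phi> Y lam \<epsilon> = 0})"

definition amalg_pressure ::
  "'a::metric_space set \<Rightarrow> nat \<Rightarrow> (nat \<Rightarrow> 'a \<Rightarrow> 'a) \<Rightarrow> (nat \<Rightarrow> 'a \<Rightarrow> real) \<Rightarrow> 'a set \<Rightarrow> ereal" where
  "amalg_pressure X m f \<Phi> Y = Lim (at_right 0) (\<lambda>\<epsilon>. amalg_pressure_at X m f \<Phi> Y \<epsilon>)"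

definition cond_ball ::
  "'a::metric_space set \<Rightarrow> nat \<Rightarrow> (nat \<Rightarrow> 'a \<Rightarrow> 'a) \<Rightarrow> nat \<Rightarrow> 'a \<Rightarrow> real \<Rightarrow> 'a set" where
  "cond_ball X m f n x \<epsilon> = (\<Inter>\<omega>\<in>seqs m. bowen_ball X f x (seq_prefix n \<omega>) \<epsilon>)"

definition lower_sum ::
  "nat \<Rightarrow> (nat \<Rightarrow> 'a \<Rightarrow> 'a) \<Rightarrow> (nat \<Rightarrow> 'a \<Rightarrow> real) \<Rightarrow> nat \<Rightarrow> 'a \<Rightarrow> real" where
  "lower_sum m f \<Phi> n x = (INF \<omega>\<in>seqs m. birkhoff_sum f \<Phi> x (seq_prefix n \<omega>))"

definition upper_sum ::
  "nat \<Rightarrow> (nat \<Rightarrow> 'a \<Rightarrow> 'a) \<Rightarrow> (nat \<Rightarrow> 'a \<Rightarrow> real) \<Rightarrow> nat \<Rightarrow> 'a \<Rightarrow> real" where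
  "upper_sum m f \<Phi> n x = (SUP \<omega>\<in>seqs m. birkhoff_sum f \<Phi> x (seq_prefix n \<omega>))"

definition cond_covers ::
  "'a::metric_space set \<Rightarrow> nat \<Rightarrow> (nat \<Rightarrow> 'a \<Rightarrow> 'a) \<Rightarrow> 'a set \<Rightarrow> nat \<Rightarrow> real
    \<Rightarrow> ('a set \<times> ('a \<Rightarrow> nat)) set" where
  "cond_covers X m f Y N \<epsilon> = {(F, n). countable F \<and> F \<subseteq> X \<and> (\<forall>x\<in>F. N \<le> n x) \<and>
     Y \<subseteq> (\<Union>x\<in>F. cond_ball X m f (n x) x \<epsilon>)}"

definition lower_M ::
  "'a::metric_space set \<Rightarrow> nat \<Rightarrow> (nat \<Rightarrow> 'a \<Rightarrow> 'a) \<Rightarrow> (nat \<Rightarrow> 'a \<Rightarrow> real) \<Rightarrow> 'a set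
    \<Rightarrow> real \<Rightarrow> nat \<Rightarrow> real \<Rightarrow> ennreal" where
  "lower_M X m f \<Phi> Y lam N \<epsilon> = (INF (F, n)\<in>cond_covers X m f Y N \<epsilon>.
     \<Sum>\<^sub>\<infinity>x\<in>F. ennreal (exp (lower_sum m f \<Phi> (n x) x - lam * real (n x))))"

definition upper_M ::
  "'a::metric_space set \<Rightarrow> nat \<Rightarrow> (nat \<Rightarrow> 'a \<Rightarrow> 'a) \<Rightarrow> (nat \<Rightarrow> 'a \<Rightarrow> real) \<Rightarrow> 'a set
    \<Rightarrow> real \<Rightarrow> nat \<Rightarrow> real \<Rightarrow> ennreal" where
  "upper_M X m f \<Phi> Y lam N \<epsilon> = (INF (F, n)\<in>cond_covers X m f Y N \<epsilon>.
     \<Sum>\<^sub>\<infinity>x\<in>F. ennreal (exp (upper_sum m f \<Phi> (n x) x - lam * real (n x))))"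

definition lower_m ::
  "'a::metric_space set \<Rightarrow> nat \<Rightarrow> (nat \<Rightarrow> 'a \<Rightarrow> 'a) \<Rightarrow> (nat \<Rightarrow> 'a \<Rightarrow> real) \<Rightarrow> 'a set
    \<Rightarrow> real \<Rightarrow> real \<Rightarrow> ennreal" where
  "lower_m X m f \<Phi> Y lam \<epsilon> = lim (\<lambda>N. lower_M X m f \<Phi> Y lam N \<epsilon>)"

definition upper_m ::
  "'a::metric_space set \<Rightarrow> nat \<Rightarrow> (nat \<Rightarrow> 'a \<Rightarrow> 'a) \<Rightarrow> (nat \<Rightarrow> 'a \<Rightarrow> real) \<Rightarrow> 'a set
    \<Rightarrow> real \<Rightarrow> real \<Rightarrow> ennreal" where
  "upper_m X m f \<Phi> Y lam \<epsilon> = lim (\<lambda>N. upper_M X m f \<Phi> Y lam N \<epsilon>)"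

definition lower_pressure_at ::
  "'a::metric_space set \<Rightarrow> nat \<Rightarrow> (nat \<Rightarrow> 'a \<Rightarrow> 'a) \<Rightarrow> (nat \<Rightarrow> 'a \<Rightarrow> real) \<Rightarrow> 'a set
    \<Rightarrow> real \<Rightarrow> ereal" where
  "lower_pressure_at X m f \<Phi> Y \<epsilon> = Inf (ereal ` {lam. lower_m X m f \<Phi> Y lam \<epsilon> = 0})"

definition upper_pressure_at ::
  "'a::metric_space set \<Rightarrow> nat \<Rightarrow> (nat \<Rightarrow> 'a \<Rightarrow> 'a) \<Rightarrow> (nat \<Rightarrow> 'a \<Rightarrow> real) \<Rightarrow> 'a set
    \<Rightarrow> real \<Rightarrow> ereal" where
  "upper_pressure_at X m f \<Phi> Y \<epsilon> = Inf (ereal ` {lam. upper_m X m f \<Phi> Y lam \<epsilon> = 0})"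

definition lower_cond_pressure ::
  "'a::metric_space set \<Rightarrow> nat \<Rightarrow> (nat \<Rightarrow> 'a \<Rightarrow> 'a) \<Rightarrow> (nat \<Rightarrow> 'a \<Rightarrow> real) \<Rightarrow> 'a set \<Rightarrow> ereal" where
  "lower_cond_pressure X m f \<Phi> Y = Lim (at_right 0) (\<lambda>\<epsilon>. lower_pressure_at X m f \<Phi> Y \<epsilon>)"

definition upper_cond_pressure ::
  "'a::metric_space set \<Rightarrow> nat \<Rightarrow> (nat \<Rightarrow> 'a \<Rightarrow> 'a) \<Rightarrow> (nat \<Rightarrow> 'a \<Rightarrow> real) \<Rightarrow> 'a set \<Rightarrow> ereal" where
  "upper_cond_pressure X m f \<Phi> Y = Lim (at_right 0) (\<lambda>\<epsilon>. upper_pressure_at X m f \<Phi> Y \<epsilon>)"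

lemma bowen_ball_mono: "\<delta> \<le> \<epsilon> \<Longrightarrow> bowen_ball X f y C \<delta> \<subseteq> bowen_ball X f y C \<epsilon>"
  unfolding bowen_ball_def by force

lemma cond_ball_mono: "\<delta> \<le> \<epsilon> \<Longrightarrow> cond_ball X m f n x \<delta> \<subseteq> cond_ball X m f n x \<epsilon>"
  unfolding cond_ball_def by (intro INF_superset_mono order_refl bowen_ball_mono)

lemma amalg_covers_mono:
  assumes "N \<le> N'" "\<delta> \<le> \<epsilon>"
  shows "amalg_covers X m f Y N' \<delta> \<subseteq> amalg_covers X m f Y N \<epsilon>"
proof
  fix \<Gamma> assume G: "\<Gamma> \<in> amalg_covers X m f Y N' \<delta>"
  have "(\<Union>(C, y)\<in>\<Gamma>. bowen_ball X f y C \<delta>) \<subseteq> (\<Union>(C, y)\<in>\<Gamma>. bowen_ball X f y C \<epsilon>)"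
    by (intro UN_mono order_refl) (auto dest: subsetD[OF bowen_ball_mono[OF assms(2)]])
  moreover have "\<forall>(C, y)\<in>\<Gamma>. N \<le> length C"
    using G assms(1) by (fastforce simp: amalg_covers_def)
  ultimately show "\<Gamma> \<in> amalg_covers X m f Y N \<epsilon>"
    using G unfolding amalg_covers_def by blast
qed

lemma cond_covers_mono:
  assumes "N \<le> N'" "\<delta> \<le> \<epsilon>"
  shows "cond_covers X m f Y N' \<delta> \<subseteq> cond_covers X m f Y N \<epsilon>"
proof (rule subrelI)
  fix F n assume G: "(F, n) \<in> cond_covers X m f Y N' \<delta>"
  have "(\<Union>x\<in>F. cond_ball X m f (n x) x \<delta>) \<subseteq> (\<Union>x\<in>F. cond_ball X m f (n x) x \<epsilon>)"
    by (intro UN_mono order_refl cond_ball_mono assms(2))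
  moreover have "\<forall>x\<in>F. N \<le> n x"
    using G assms(1) by (fastforce simp: cond_covers_def)
  ultimately show "(F, n) \<in> cond_covers X m f Y N \<epsilon>"
    using G unfolding cond_covers_def by blast
qed

lemma M_mono:
  assumes "N \<le> N'" "\<delta> \<le> \<epsilon>"
  shows "amalg_M X m f \<Phi> Y lam N \<epsilon> \<le> amalg_M X m f \<Phi> Y lam N' \<delta>"
    and "lower_M X m f \<Phi> Y lam N \<epsilon> \<le> lower_M X m f \<Phi> Y lam N' \<delta>"
    and "upper_M X m f \<Phi> Y lam N \<epsilon> \<le> upper_M X m f \<Phi> Y lam N' \<delta>"
  unfolding amalg_M_def lower_M_def upper_M_def
  by (intro INF_superset_mono amalg_covers_mono cond_covers_mono assms order_refl)+

lemma m_LIMSEQ: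
  "(\<lambda>N. amalg_M X m f \<Phi> Y lam N \<epsilon>) \<longlonglongrightarrow> amalg_m X m f \<Phi> Y lam \<epsilon>"
  "(\<lambda>N. lower_M X m f \<Phi> Y lam N \<epsilon>) \<longlonglongrightarrow> lower_m X m f \<Phi> Y lam \<epsilon>"
  "(\<lambda>N. upper_M X m f \<Phi> Y lam N \<epsilon>) \<longlonglongrightarrow> upper_m X m f \<Phi> Y lam \<epsilon>"
proof -
  have *: "g \<longlonglongrightarrow> lim g" if "incseq g" for g :: "nat \<Rightarrow> ennreal"
    using LIMSEQ_SUP[OF that] limI[OF LIMSEQ_SUP[OF that]] by simp
  show "(\<lambda>N. amalg_M X m f \<Phi> Y lam N \<epsilon>) \<longlonglongrightarrow> amalg_m X m f \<Phi> Y lam \<epsilon>"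
    "(\<lambda>N. lower_M X m f \<Phi> Y lam N \<epsilon>) \<longlonglongrightarrow> lower_m X m f \<Phi> Y lam \<epsilon>"
    "(\<lambda>N. upper_M X m f \<Phi> Y lam N \<epsilon>) \<longlonglongrightarrow> upper_m X m f \<Phi> Y lam \<epsilon>"
    unfolding amalg_m_def lower_m_def upper_m_def
    by (intro * monoI M_mono order_refl; assumption)+
qed

lemma m_antimono:
  assumes "\<delta> \<le> \<epsilon>"
  shows "amalg_m X m f \<Phi> Y lam \<epsilon> \<le> amalg_m X m f \<Phi> Y lam \<delta>"
    and "lower_m X m f \<Phi> Y lam \<epsilon> \<le> lower_m X m f \<Phi> Y lam \<delta>"
    and "upper_m X m f \<Phi> Y lam \<epsilon> \<le> upper_m X m f \<Phi> Y lam \<delta>"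
  by (rule LIMSEQ_le[OF m_LIMSEQ(1) m_LIMSEQ(1)] LIMSEQ_le[OF m_LIMSEQ(2) m_LIMSEQ(2)]
        LIMSEQ_le[OF m_LIMSEQ(3) m_LIMSEQ(3)],
      intro exI[of _ 0] allI impI M_mono order_refl assms)+

lemma pressure_at_antimono:
  assumes "\<delta> \<le> \<epsilon>"
  shows "amalg_pressure_at X m f \<Phi> Y \<epsilon> \<le> amalg_pressure_at X m f \<Phi> Y \<delta>"
    and "lower_pressure_at X m f \<Phi> Y \<epsilon> \<le> lower_pressure_at X m f \<Phi> Y \<delta>"
    and "upper_pressure_at X m f \<Phi> Y \<epsilon> \<le> upper_pressure_at X m f \<Phi> Y \<delta>"
proof -
  have z: "a = 0" if "a \<le> b" "b = 0" for a b :: ennreal using that by simp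
  show "amalg_pressure_at X m f \<Phi> Y \<epsilon> \<le> amalg_pressure_at X m f \<Phi> Y \<delta>"
    unfolding amalg_pressure_at_def
    by (intro Inf_superset_mono image_mono Collect_mono impI) (rule z[OF m_antimono(1)[OF assms]])
  show "lower_pressure_at X m f \<Phi> Y \<epsilon> \<le> lower_pressure_at X m f \<Phi> Y \<delta>"
    unfolding lower_pressure_at_def
    by (intro Inf_superset_mono image_mono Collect_mono impI) (rule z[OF m_antimono(2)[OF assms]])
  show "upper_pressure_at X m f \<Phi> Y \<epsilon> \<le> upper_pressure_at X m f \<Phi> Y \<delta>"
    unfolding upper_pressure_at_def
    by (intro Inf_superset_mono image_mono Collect_mono impI) (rule z[OF m_antimono(3)[OF assms]])
qed

lemma antimono_tendsto_Lim_at_right: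
  fixes g :: "real \<Rightarrow> ereal"
  assumes "\<And>\<delta> \<epsilon>. \<delta> \<le> \<epsilon> \<Longrightarrow> g \<epsilon> \<le> g \<delta>"
  shows "(g \<longlongrightarrow> Lim (at_right 0) g) (at_right 0)"
proof -
  have "(g \<longlongrightarrow> (SUP \<epsilon>\<in>{0<..}. g \<epsilon>)) (at_right 0)"
  proof (rule order_tendstoI)
    fix a assume "a < (SUP \<epsilon>\<in>{0<..}. g \<epsilon>)"
    then obtain e where e: "e > 0" "a < g e" by (auto simp: less_SUP_iff)
    show "\<forall>\<^sub>F x in at_right 0. a < g x"
      unfolding eventually_at_right_field
      using e assms by (intro exI[of _ e]) (auto intro: less_le_trans)
  next
    fix a assume a: "(SUP \<epsilon>\<in>{0<..}. g \<epsilon>) < a"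
    have "g x < a" if "x > 0" for x
      using le_less_trans[OF SUP_upper a, of x] that by auto
    then show "\<forall>\<^sub>F x in at_right 0. g x < a"
      unfolding eventually_at_right_field by (intro exI[of _ 1]) auto
  qed
  then show ?thesis
    using tendsto_Lim[of "at_right (0::real)" g] by simp
qed

lemma pressure_tendsto:
  "((\<lambda>\<epsilon>. amalg_pressure_at X m f \<Phi> Y \<epsilon>) \<longlongrightarrow> amalg_pressure X m f \<Phi> Y) (at_right 0)"
  "((\<lambda>\<epsilon>. lower_pressure_at X m f \<Phi> Y \<epsilon>) \<longlongrightarrow> lower_cond_pressure X m f \<Phi> Y) (at_right 0)"
  "((\<lambda>\<epsilon>. upper_pressure_at X m f \<Phi> Y \<epsilon>) \<longlongrightarrow> upper_cond_pressure X m f \<Phi> Y) (at_right 0)"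
  unfolding amalg_pressure_def lower_cond_pressure_def upper_cond_pressure_def
  by (intro antimono_tendsto_Lim_at_right pressure_at_antimono; assumption)+

end

theory Submission
  imports Defs
begin

text \<open>
  The prefixes of length \<open>n\<close> of sequences over a finite alphabet form a finite set, so the infimum
  defining the lower sum at \<open>x\<close> is attained along some sequence \<open>\<omega>\<close>. Since the condensed ball at
  \<open>x\<close> lies in the Bowen ball along that very \<open>\<omega>\<close>, every condensed cover turns into an amalgamated
  cover with the same exponential sum. The second inequality is the termwise bound of the lower sum
  by the upper sum.
\<close>

lemma seqs_nonempty: "1 \<le> m \<Longrightarrow> seqs m \<noteq> {}"
  by (auto simp: seqs_def intro!: exI[of _ "\<lambda>_. 1"])

lemma length_seq_prefix [simp]: "length (seq_prefix n \<omega>) = n"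
  by (simp add: seq_prefix_def)

lemma seq_prefix_in_words:
  assumes "\<omega> \<in> seqs m" "1 \<le> n"
  shows "seq_prefix n \<omega> \<in> words m"
  using assms by (auto simp: seq_prefix_def words_def seqs_def)

lemma finite_seq_prefixes: "finite (seq_prefix n ` seqs m)"
proof (rule finite_subset)
  show "seq_prefix n ` seqs m \<subseteq> {C. set C \<subseteq> {1..m} \<and> length C = n}"
    by (fastforce simp: seq_prefix_def seqs_def)
qed (simp add: finite_lists_length_eq)

lemma finite_birkhoff_sums: "finite ((\<lambda>\<omega>. birkhoff_sum f \<Phi> x (seq_prefix n \<omega>)) ` seqs m)"
  using finite_imageI[OF finite_seq_prefixes, of "birkhoff_sum f \<Phi> x" n m]
  by (simp add: image_image)

text \<open>Only finitely many values occur, and \<open>1 \<le> m\<close> makes their set nonempty,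
  so the infimum is a minimum. Attainment yields a single sequence with exact equality, so the later
  comparison carries no error term.\<close>

lemma lower_sum_attained:
  assumes "1 \<le> m"
  shows "\<exists>\<omega>\<in>seqs m. lower_sum m f \<Phi> n x = birkhoff_sum f \<Phi> x (seq_prefix n \<omega>)"
proof -
  let ?S = "(\<lambda>\<omega>. birkhoff_sum f \<Phi> x (seq_prefix n \<omega>)) ` seqs m"
  have ne: "?S \<noteq> {}"
    using seqs_nonempty[OF assms] by simp
  have "lower_sum m f \<Phi> n x = Min ?S"
    unfolding lower_sum_def using finite_birkhoff_sums ne by (rule cInf_eq_Min)
  with Min_in[OF finite_birkhoff_sums ne] show ?thesis
    by auto
qed

lemma lower_sum_le_upper_sum:
  assumes "1 \<le> m"
  shows "lower_sum m f \<Phi> n x \<le> upper_sum m f \<Phi> n x"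
proof -
  obtain \<omega> where "\<omega> \<in> seqs m" "lower_sum m f \<Phi> n x = birkhoff_sum f \<Phi> x (seq_prefix n \<omega>)"
    using lower_sum_attained[OF assms, of f \<Phi> n x] by blast
  then show ?thesis
    unfolding upper_sum_def
    by (auto intro!: cSUP_upper bounded_imp_bdd_above finite_imp_bounded finite_birkhoff_sums)
qed

text \<open>The bound \<open>1 \<le> N\<close> forces \<open>n x\<close> to be positive on the
  cover, so the chosen prefixes are nonempty, as \<open>words m\<close> demands.\<close>

lemma amalg_M_le_lower_M:
  assumes "1 \<le> m" "1 \<le> N"
  shows "amalg_M X m f \<Phi> Y lam N \<epsilon> \<le> lower_M X m f \<Phi> Y lam N \<epsilon>"
  unfolding lower_M_def
proof (rule INF_greatest, safe)
  fix F n assume cover: "(F, n) \<in> cond_covers X m f Y N \<epsilon>"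
  have "\<forall>x. \<exists>\<omega>. \<omega> \<in> seqs m \<and>
      lower_sum m f \<Phi> (n x) x = birkhoff_sum f \<Phi> x (seq_prefix (n x) \<omega>)"
    using lower_sum_attained[OF assms(1), of f \<Phi>] by blast
  from choice[OF this] obtain w where w: "\<And>x. w x \<in> seqs m"
    "\<And>x. lower_sum m f \<Phi> (n x) x = birkhoff_sum f \<Phi> x (seq_prefix (n x) (w x))"
    by blast
  \<comment> \<open>Each centre is paired with a prefix along which its lower sum is attained. The
    cover may use different words at different centres.\<close>
  define h where "h x = (seq_prefix (n x) (w x), x)" for x
  have "cond_ball X m f (n x) x \<epsilon> \<subseteq> bowen_ball X f x (seq_prefix (n x) (w x)) \<epsilon>" for x
    using w(1) by (auto simp: cond_ball_def)
  moreover have "seq_prefix (n x) (w x) \<in> words m" if "x \<in> F" for x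
    using cover that assms(2) by (intro seq_prefix_in_words w(1)) (auto simp: cond_covers_def)
  ultimately have "h ` F \<in> amalg_covers X m f Y N \<epsilon>"
    using cover by (fastforce simp: amalg_covers_def cond_covers_def h_def)
  then have "amalg_M X m f \<Phi> Y lam N \<epsilon> \<le>
      (\<Sum>\<^sub>\<infinity>(C, y)\<in>h ` F. ennreal (exp (- lam * real (length C) + birkhoff_sum f \<Phi> y C)))"
    unfolding amalg_M_def by (rule INF_lower)
  also have "\<dots> = (\<Sum>\<^sub>\<infinity>x\<in>F. ennreal (exp (lower_sum m f \<Phi> (n x) x - lam * real (n x))))"
    \<comment> \<open>The second component of \<open>h x\<close> is \<open>x\<close>, so
      \<open>h\<close> is injective and no terms merge under reindexing.\<close>
    by (subst infsum_reindex) (auto simp: h_def inj_on_def w(2) intro!: infsum_cong)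
  finally show "amalg_M X m f \<Phi> Y lam N \<epsilon> \<le>
      (\<Sum>\<^sub>\<infinity>x\<in>F. ennreal (exp (lower_sum m f \<Phi> (n x) x - lam * real (n x))))" .
qed

text \<open>Both infima range over the same covers, so a termwise bound suffices; sums in
  \<open>ennreal\<close> always exist.\<close>

lemma lower_M_le_upper_M:
  assumes "1 \<le> m"
  shows "lower_M X m f \<Phi> Y lam N \<epsilon> \<le> upper_M X m f \<Phi> Y lam N \<epsilon>"
  unfolding lower_M_def upper_M_def
  by (rule INF_mono')
     (auto intro!: infsum_mono nonneg_summable_on_complete ennreal_leI lower_sum_le_upper_sum assms)

lemma amalg_m_le_lower_m:
  assumes "1 \<le> m"
  shows "amalg_m X m f \<Phi> Y lam \<epsilon> \<le> lower_m X m f \<Phi> Y lam \<epsilon>"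
  \<comment> \<open>The comparison is available for \<open>N \<ge> 1\<close>, and an eventual
    inequality is enough for the limits.\<close>
  using amalg_M_le_lower_M[OF assms] by (blast intro: LIMSEQ_le[OF m_LIMSEQ(1) m_LIMSEQ(2)])

lemma lower_m_le_upper_m:
  assumes "1 \<le> m"
  shows "lower_m X m f \<Phi> Y lam \<epsilon> \<le> upper_m X m f \<Phi> Y lam \<epsilon>"
  using lower_M_le_upper_M[OF assms] by (blast intro: LIMSEQ_le[OF m_LIMSEQ(2) m_LIMSEQ(3)])

text \<open>Where the larger limit vanishes, so does the smaller one; the infimum on the left is
  thus over a larger set of exponents.\<close>

lemma amalg_pressure_at_le_lower_pressure_at:
  assumes "1 \<le> m"
  shows "amalg_pressure_at X m f \<Phi> Y \<epsilon> \<le> lower_pressure_at X m f \<Phi> Y \<epsilon>"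
  unfolding amalg_pressure_at_def lower_pressure_at_def
  using amalg_m_le_lower_m[OF assms, of X f \<Phi> Y _ \<epsilon>]
  by (intro Inf_superset_mono image_mono Collect_mono impI) (metis le_zero_eq)

lemma lower_pressure_at_le_upper_pressure_at:
  assumes "1 \<le> m"
  shows "lower_pressure_at X m f \<Phi> Y \<epsilon> \<le> upper_pressure_at X m f \<Phi> Y \<epsilon>"
  unfolding lower_pressure_at_def upper_pressure_at_def
  using lower_m_le_upper_m[OF assms, of X f \<Phi> Y _ \<epsilon>]
  by (intro Inf_superset_mono image_mono Collect_mono impI) (metis le_zero_eq)

theorem theorem3p13:
  fixes X Y :: "'a::metric_space set"
    and m :: nat
    and f :: "nat \<Rightarrow> 'a \<Rightarrow> 'a"
    and \<Phi> :: "nat \<Rightarrow> 'a \<Rightarrow> real"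
  assumes "compact X"
    and "1 \<le> m"
    and "\<And>j. j \<in> {1..m} \<Longrightarrow> continuous_on X (f j)"
    and "\<And>j. j \<in> {1..m} \<Longrightarrow> f j ` X \<subseteq> X"
    and "\<And>j. j \<in> {1..m} \<Longrightarrow> continuous_on X (\<Phi> j)"
    and "Y \<subseteq> X"
  shows "amalg_pressure X m f \<Phi> Y \<le> lower_cond_pressure X m f \<Phi> Y
       \<and> lower_cond_pressure X m f \<Phi> Y \<le> upper_cond_pressure X m f \<Phi> Y"
proof
  show "amalg_pressure X m f \<Phi> Y \<le> lower_cond_pressure X m f \<Phi> Y"
    \<comment> \<open>The inequality holds at every scale and \<open>at_right 0\<close> is a
      nontrivial filter, so it passes to the limit.\<close>
    by (rule tendsto_le[OF _ pressure_tendsto(2) pressure_tendsto(1)])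
       (simp_all add: amalg_pressure_at_le_lower_pressure_at[OF assms(2)])
  show "lower_cond_pressure X m f \<Phi> Y \<le> upper_cond_pressure X m f \<Phi> Y"
    by (rule tendsto_le[OF _ pressure_tendsto(3) pressure_tendsto(2)])
       (simp_all add: lower_pressure_at_le_upper_pressure_at[OF assms(2)])
qed

end
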